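(* For every integer $n\geq 2$, let $K$ be a random variable on $\{1,\dots,n\}$ with $\mathbb{P}[K=k]=\pi(k)=N(n,k)/C_n$, and let $\mu=\frac{n+1}{2}$ and $\sigma^2=\frac{(n-1)(n+1)}{4(2n-1)}$. Then $$d_{\mathrm{TV}}\bigl(\mathscr{L}(K),\widehat{\mathrm{Bi}}(\mu,\sigma^2)\bigr)\leq \frac{12}{n}.$$
   Context: Narayana numbers: $N(n,k)=\frac1n\binom{n}{k-1}\binom{n}{k}$ for $1\le k\le n$. Catalan numbers: $C_n=\frac{1}{n+1}\binom{2n}{n}=\sum_{k=1}^n N(n,k)$. Thus $\pi(k)=N(n,k)/C_n$ is a probability distribution on $\{1,\dots,n\}$. $\mathscr{L}(K)$ denotes the law of $K$. For probability measures $P,Q$ on $\mathbb{Z}$, $d_{\mathrm{TV}}(P,Q)=\sup_{A\subset\mathbb{Z}}|P[A]-Q[A]|$. For real $x$, $\lfloor x\rfloor$ and $\lceil x\rceil$ are the floor and ceiling, and $\langle x\rangle=x-\lfloor x\rfloor$. Given $\mu\in\mathbb{R}$ and $\sigma^2>0$, let $\delta=\langle-4\sigma^2\rangle$ (so $\lceil4\sigma^2\rceil=4\sigma^2+\delta$) and $t=\langle-\mu+2\sigma^2+\delta/2\rangle/\lceil4\sigma^2\rceil$. The translated (almost) symmetric binomial distribution $\widehat{\mathrm{Bi}}(\mu,\sigma^2)$ is the binomial distribution $\mathrm{Bi}(\lceil4\sigma^2\rceil,\tfrac12-t)$ shifted by $\mu-\lceil4\sigma^2\rceil(\tfrac12-t)$,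 i.e. the law of $Y+\mu-\lceil4\sigma^2\rceil(\tfrac12-t)$ with $Y\sim\mathrm{Bi}(\lceil4\sigma^2\rceil,\tfrac12-t)$ (number of trials, success probability). The shift is an integer. *)

theory Defs
  imports "HOL-Probability.Probability"
begin

definition narayana :: "nat \<Rightarrow> nat \<Rightarrow> real" where
  "narayana n k = 1 / real n * real (n choose (k - 1)) * real (n choose k)"

definition catalan :: "nat \<Rightarrow> real" where
  "catalan n = 1 / (real n + 1) * real ((2 * n) choose n)"

lemma sum_narayana:
  assumes "n \<ge> 1"
  shows "(\<Sum>k=1..n. narayana n k) = catalan n"
proof -
  have "(\<Sum>k=1..n. (n choose (k - 1)) * (n choose k)) =
        (\<Sum>k=1..n. (n choose k) * (n choose (n + 1 - k)))"
  proof (rule sum.cong)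
    fix k assume "k \<in> {1..n}"
    then have "n choose (k - 1) = n choose (n - (k - 1))" and "n - (k - 1) = n + 1 - k"
      using binomial_symmetric[of "k - 1" n] by auto
    then show "(n choose (k - 1)) * (n choose k) = (n choose k) * (n choose (n + 1 - k))"
      by (simp only: mult.commute)
  qed simp
  also have "\<dots> = (\<Sum>k\<le>n+1. (n choose k) * (n choose (n + 1 - k)))"
    by (intro sum.mono_neutral_left) (auto simp: not_le Suc_le_eq binomial_eq_0)
  also have "\<dots> = (2 * n) choose (n + 1)"
    by (simp add: vandermonde mult_2)
  finally have S: "(\<Sum>k=1..n. (n choose (k - 1)) * (n choose k)) = (2 * n) choose (n + 1)" .
  have "Suc n * ((2 * n) choose Suc n) = n * ((2 * n) choose n)"
    using binomial_absorb_comp[of "2 * n" n] binomial_absorption[of n "2 * n"]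
    by (metis add_diff_cancel_right' mult_2)
  then have C: "(real n + 1) * real ((2 * n) choose (n + 1)) = real n * real ((2 * n) choose n)"
    by (metis Suc_eq_plus1 of_nat_Suc of_nat_mult add.commute)
  have "(\<Sum>k=1..n. narayana n k) =
        1 / real n * real (\<Sum>k=1..n. (n choose (k - 1)) * (n choose k))"
    by (simp add: narayana_def sum_distrib_left mult.assoc)
  also have "\<dots> = catalan n"
    using C assms unfolding S catalan_def by (simp add: field_simps)
  finally show ?thesis .
qed

definition tv_dist :: "int measure \<Rightarrow> int measure \<Rightarrow> real" where
  "tv_dist P Q = (SUP A. \<bar>measure P A - measure Q A\<bar>)"

text \<open>The parameters of the translated (almost) symmetric binomial distribution
  with mean parameter \<open>\<mu>\<close> and variance parameter \<open>v = \<sigma>\<^sup>2\<close>.\<close>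

definition tbin_delta :: "real \<Rightarrow> real" where
  "tbin_delta v = frac (- 4 * v)"

definition tbin_t :: "real \<Rightarrow> real \<Rightarrow> real" where
  "tbin_t \<mu> v = frac (- \<mu> + 2 * v + tbin_delta v / 2) / real_of_int \<lceil>4 * v\<rceil>"

definition tbin_shift :: "real \<Rightarrow> real \<Rightarrow> real" where
  "tbin_shift \<mu> v = \<mu> - real_of_int \<lceil>4 * v\<rceil> * (1 / 2 - tbin_t \<mu> v)"

text \<open>The shift is an integer (\<open>tbin_shift_Ints\<close>), so the floor only changes its type.
  The library's \<^const>\<open>binomial_pmf\<close> is meaningful for success probabilities in
  \<open>[0,1]\<close> only; the number \<open>1/2 - t\<close> can be negative when \<open>v \<le> 1/4\<close>, but not otherwise
  (\<open>tbin_success_prob\<close>), and not when \<open>v = 1/4\<close> and \<open>\<mu> = 3/2\<close> (\<open>tbin_success_prob_small\<close>).\<close>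

definition tbin_pmf :: "real \<Rightarrow> real \<Rightarrow> int pmf" where
  "tbin_pmf \<mu> v =
     map_pmf (\<lambda>y. int y + \<lfloor>tbin_shift \<mu> v\<rfloor>)
       (binomial_pmf (nat \<lceil>4 * v\<rceil>) (1 / 2 - tbin_t \<mu> v))"

lemma tbin_ceiling: "real_of_int \<lceil>4 * v\<rceil> = 4 * v + tbin_delta v"
  by (simp add: tbin_delta_def frac_def ceiling_def)

lemma tbin_shift_Ints:
  assumes "v > 0"
  shows "tbin_shift \<mu> v \<in> \<int>"
proof -
  have "real_of_int \<lceil>4 * v\<rceil> \<noteq> 0"
    using assms by (smt (verit) le_of_int_ceiling)
  then have "real_of_int \<lceil>4 * v\<rceil> * tbin_t \<mu> v = frac (- \<mu> + 2 * v + tbin_delta v / 2)"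
    by (simp add: tbin_t_def)
  then have "tbin_shift \<mu> v =
      \<mu> - (4 * v + tbin_delta v) / 2 + frac (- \<mu> + 2 * v + tbin_delta v / 2)"
    using tbin_ceiling[of v] by (simp add: tbin_shift_def right_diff_distrib)
  also have "\<dots> = real_of_int (- \<lfloor>- \<mu> + 2 * v + tbin_delta v / 2\<rfloor>)"
    by (simp add: frac_def field_simps)
  finally show ?thesis by simp
qed

lemma tbin_success_prob:
  assumes "v > 1 / 4"
  shows "1 / 2 - tbin_t \<mu> v \<in> {0..1}"
proof -
  have "\<lceil>4 * v\<rceil> \<ge> 2" using assms by linarith
  then have c: "real_of_int \<lceil>4 * v\<rceil> \<ge> 2" by linarith
  define x where "x = frac (- \<mu> + 2 * v + tbin_delta v / 2)"
  have x: "0 \<le> x" "x < 1" by (simp_all add: x_def frac_lt_1)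
  have "x / real_of_int \<lceil>4 * v\<rceil> \<le> 1 / 2"
    using frac_le[OF _ less_imp_le[OF x(2)] _ c] by simp
  moreover have "x / real_of_int \<lceil>4 * v\<rceil> \<ge> 0" using c x by simp
  ultimately show ?thesis by (simp add: tbin_t_def x_def)
qed

lemma tbin_success_prob_small: "1 / 2 - tbin_t (3 / 2) (1 / 4) = 1 / 2"
  by (simp add: tbin_t_def tbin_delta_def frac_def)

end

(* The Narayana law pi is the stationary law of the birth-death chain on {1..n} with birth
   rates (n-k)(n-k+1) and death rates k(k-1). Its drift is linear in k, so the chain has spectral
   gap 2n (a Poincare inequality with that constant, by Cauchy-Schwarz and a telescoping sum).
   Apply it to sqrt(Q/pi), Q the translated binomial: the variance is 1 - BC^2, BC being the
   Bhattacharyya coefficient, so it dominates the squared total variation distance, while in the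
   Dirichlet form pi cancels. There remains the mean, under a binomial law, of the square of a
   cubic polynomial in the deviation w from n/2. The leading terms of that cubic cancel because
   Q matches the mean and nearly the variance of pi; binomial moments up to order 6 show that
   the variance is at most (12/n)^2 once n > 12, and for n <= 12 there is nothing to prove. *)

theory Submission
  imports Defs
begin

subsection \<open>Poincare inequality for the Narayana distribution\<close>

text \<open>Exchanges \<open>x\<close> and \<open>y\<close> in half of the sum. It later merges a
  non-symmetric kernel into a square over the pairs \<open>x < y\<close>.\<close>

lemma sum_pairs_less:
  fixes f :: "nat \<Rightarrow> nat \<Rightarrow> real"
  shows "(\<Sum>x\<in>{1..n}. \<Sum>y\<in>{1..n}. if x < y then f x y + f y x else 0)
       = (\<Sum>x\<in>{1..n}. \<Sum>y\<in>{1..n}. if x \<noteq> y then f x y else 0)"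
proof -
  have "(\<Sum>x\<in>{1..n}. \<Sum>y\<in>{1..n}. if x < y then f x y + f y x else 0)
      = (\<Sum>x\<in>{1..n}. \<Sum>y\<in>{1..n}. if x < y then f x y else 0)
        + (\<Sum>x\<in>{1..n}. \<Sum>y\<in>{1..n}. if x < y then f y x else 0)"
    unfolding sum.distrib[symmetric] by (intro sum.cong refl) auto
  also have "(\<Sum>x\<in>{1..n}. \<Sum>y\<in>{1..n}. if x < y then f y x else 0)
      = (\<Sum>x\<in>{1..n}. \<Sum>y\<in>{1..n}. if y < x then f x y else 0)"
    by (rule sum.swap)
  finally show ?thesis
    unfolding sum.distrib[symmetric] by (auto intro!: sum.cong)
qed

text \<open>Cauchy-Schwarz against the constant 1 on the telescoping sum; affine \<open>g\<close>
  gives equality.\<close>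

lemma square_diff_le_sum_increments:
  fixes g :: "nat \<Rightarrow> real"
  assumes "x \<le> y"
  shows "(g y - g x)\<^sup>2 \<le> (real y - real x) * (\<Sum>z\<in>{x..<y}. (g (Suc z) - g z)\<^sup>2)"
proof -
  have "g y - g x = (\<Sum>z\<in>{x..<y}. 1 * (g (Suc z) - g z))"
    using sum_Suc_diff'[OF assms, of g] by simp
  also have "\<dots>\<^sup>2 \<le> (\<Sum>z\<in>{x..<y}. 1\<^sup>2) * (\<Sum>z\<in>{x..<y}. (g (Suc z) - g z)\<^sup>2)"
    by (rule Cauchy_Schwarz_ineq_sum)
  finally show ?thesis using assms by (simp add: of_nat_diff)
qed

text \<open>The left side is the variance of \<open>g\<close> under \<open>P\<close>. Each
  \<open>g y - g x\<close> is telescoped, and the terms crossing the edge from \<open>z\<close> to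
  \<open>z + 1\<close> are collected: the weight of that edge, a discrete Stein kernel, is a centred
  tail sum of \<open>P\<close>.\<close>

lemma discrete_poincare:
  fixes P g :: "nat \<Rightarrow> real" and m :: real
  assumes P: "\<And>k. P k \<ge> 0" and one: "(\<Sum>k\<in>{1..n}. P k) = 1"
    and mean: "(\<Sum>k\<in>{1..n}. real k * P k) = m"
  shows "(\<Sum>x\<in>{1..n}. \<Sum>y\<in>{1..n}. if x < y then P x * P y * (g y - g x)\<^sup>2 else 0)
       \<le> (\<Sum>z\<in>{1..<n}. (\<Sum>y\<in>{z<..n}. (real y - m) * P y) * (g (Suc z) - g z)\<^sup>2)"
proof -
  define D where "D z = (g (Suc z) - g z)\<^sup>2" for z
  \<comment> \<open>Total mass 1 and mean \<open>m\<close> turn the sums over \<open>x\<close> into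
    tail sums as well; the products of tails then cancel.\<close>
  have kernel: "(\<Sum>x\<in>{1..n}. \<Sum>y\<in>{1..n}. if x \<le> z \<and> z < y then P x * P y * (real y - real x) else 0)
      = (\<Sum>y\<in>{z<..n}. (real y - m) * P y)" if z: "z \<in> {1..<n}" for z
  proof -
    have split: "{1..n} = {1..z} \<union> {z<..n}" "{1..z} \<inter> {z<..n} = {}" using z by auto
    have one': "(\<Sum>k\<in>{1..z}. P k) = 1 - (\<Sum>k\<in>{z<..n}. P k)"
      using one unfolding split(1) by (subst (asm) sum.union_disjoint) auto
    have mean': "(\<Sum>k\<in>{1..z}. real k * P k) = m - (\<Sum>k\<in>{z<..n}. real k * P k)"
      using mean unfolding split(1) by (subst (asm) sum.union_disjoint) auto
    have "(\<Sum>x\<in>{1..n}. \<Sum>y\<in>{1..n}. if x \<le> z \<and> z < y then P x * P y * (real y - real x) else 0)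
       = (\<Sum>x\<in>{1..n}. if x \<le> z then (\<Sum>y\<in>{z<..n}. P x * P y * (real y - real x)) else 0)"
    proof (intro sum.cong refl)
      fix x assume "x \<in> {1..n}"
      show "(\<Sum>y\<in>{1..n}. if x \<le> z \<and> z < y then P x * P y * (real y - real x) else 0)
        = (if x \<le> z then (\<Sum>y\<in>{z<..n}. P x * P y * (real y - real x)) else 0)"
        using z by (cases "x \<le> z") (auto intro!: sum.mono_neutral_cong_right)
    qed
    also have "\<dots> = (\<Sum>x\<in>{1..z}. \<Sum>y\<in>{z<..n}. P x * P y * (real y - real x))"
      using z by (auto intro!: sum.mono_neutral_cong_right)
    also have "\<dots> = (\<Sum>x\<in>{1..z}. \<Sum>y\<in>{z<..n}. P x * (real y * P y))
        - (\<Sum>x\<in>{1..z}. \<Sum>y\<in>{z<..n}. (real x * P x) * P y)"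
      unfolding sum_subtractf[symmetric] by (intro sum.cong refl) (simp add: algebra_simps)
    also have "\<dots> = (\<Sum>x\<in>{1..z}. P x) * (\<Sum>y\<in>{z<..n}. real y * P y)
        - (\<Sum>x\<in>{1..z}. real x * P x) * (\<Sum>y\<in>{z<..n}. P y)"
      unfolding sum_product ..
    also have "\<dots> = (\<Sum>y\<in>{z<..n}. real y * P y) - m * (\<Sum>y\<in>{z<..n}. P y)"
      unfolding one' mean' by (simp add: algebra_simps)
    also have "\<dots> = (\<Sum>y\<in>{z<..n}. (real y - m) * P y)"
      by (simp add: sum_distrib_left sum_subtractf[symmetric] algebra_simps)
    finally show ?thesis .
  qed
  have "(\<Sum>x\<in>{1..n}. \<Sum>y\<in>{1..n}. if x < y then P x * P y * (g y - g x)\<^sup>2 else 0)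
     \<le> (\<Sum>x\<in>{1..n}. \<Sum>y\<in>{1..n}. \<Sum>z\<in>{1..<n}.
          D z * (if x \<le> z \<and> z < y then P x * P y * (real y - real x) else 0))"
  proof (intro sum_mono)
    fix x y assume x: "x \<in> {1..n}" and y: "y \<in> {1..n}"
    show "(if x < y then P x * P y * (g y - g x)\<^sup>2 else 0)
      \<le> (\<Sum>z\<in>{1..<n}. D z * (if x \<le> z \<and> z < y then P x * P y * (real y - real x) else 0))"
    proof (cases "x < y")
      case True
      have "P x * P y * (g y - g x)\<^sup>2 \<le> P x * P y * ((real y - real x) * (\<Sum>z\<in>{x..<y}. D z))"
        unfolding D_def using P square_diff_le_sum_increments[of x y g] True
        by (intro mult_left_mono) auto
      also have "\<dots> = (\<Sum>z\<in>{x..<y}. D z * (P x * P y * (real y - real x)))"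
        by (simp add: sum_distrib_left algebra_simps)
      also have "\<dots> = (\<Sum>z\<in>{1..<n}. D z * (if x \<le> z \<and> z < y then P x * P y * (real y - real x) else 0))"
        using x y True by (intro sum.mono_neutral_cong_left) auto
      finally show ?thesis using True by simp
    qed (auto intro!: sum_nonneg mult_nonneg_nonneg simp: D_def P)
  qed
  also have "\<dots> = (\<Sum>x\<in>{1..n}. \<Sum>z\<in>{1..<n}. \<Sum>y\<in>{1..n}.
          D z * (if x \<le> z \<and> z < y then P x * P y * (real y - real x) else 0))"
    by (rule sum.cong[OF refl], rule sum.swap)
  also have "\<dots> = (\<Sum>z\<in>{1..<n}. \<Sum>x\<in>{1..n}. \<Sum>y\<in>{1..n}.
          D z * (if x \<le> z \<and> z < y then P x * P y * (real y - real x) else 0))"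
    by (rule sum.swap)
  also have "\<dots> = (\<Sum>z\<in>{1..<n}. D z * (\<Sum>y\<in>{z<..n}. (real y - m) * P y))"
    unfolding sum_distrib_left[symmetric] by (intro sum.cong refl) (simp only: kernel)
  finally show ?thesis by (simp add: D_def mult.commute)
qed

section \<open>Narayana weights: detailed balance, tail sums and mean\<close>

text \<open>Detailed balance across the edge from \<open>k\<close> to \<open>k + 1\<close>. Each of
  the two binomial factors of the weight supplies one linear factor by absorption.\<close>

lemma narayana_Suc:
  assumes "1 \<le> k" "k < n"
  shows "narayana n k * ((real n - real k) * (real n - real k + 1))
    = narayana n (Suc k) * (real k * (real k + 1))"
proof -
  obtain j where k: "k = Suc j" using assms by (cases k) auto
  have 1: "real (n choose Suc k) * (real k + 1) = real (n choose k) * (real n - real k)"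
    using binomial_absorb_comp[of n k] binomial_absorption[of k n] assms
    by (metis (no_types, lifting) of_nat_Suc add.commute binomial_absorption less_imp_le mult.commute of_nat_diff of_nat_mult)
  have 2: "real (n choose k) * real k = real (n choose j) * (real n - real k + 1)"
  proof -
    have "Suc j * (n choose Suc j) = (n - j) * (n choose j)"
      by (metis binomial_absorb_comp binomial_absorption)
    then have "real (Suc j) * real (n choose Suc j) = real (n - j) * real (n choose j)"
      by (metis of_nat_mult)
    then show ?thesis using assms by (simp add: k of_nat_diff mult.commute)
  qed
  have "narayana n k * ((real n - real k) * (real n - real k + 1))
    = 1 / real n * (real (n choose j) * (real n - real k + 1)) * (real (n choose k) * (real n - real k))"
    by (simp add: narayana_def k)
  also have "\<dots> = 1 / real n * (real (n choose k) * real k) * (real (n choose Suc k) * (real k + 1))"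
    unfolding 1 2 ..
  finally show ?thesis by (simp add: narayana_def mult_ac)
qed

lemma narayana_nonneg: "narayana n k \<ge> 0"
  by (simp add: narayana_def)

lemma catalan_pos: "catalan n > 0"
  by (simp add: catalan_def)

lemma narayana_pos: "1 \<le> k \<Longrightarrow> k \<le> n \<Longrightarrow> narayana n k > 0"
  by (simp add: narayana_def)

text \<open>Downward induction from \<open>z = n\<close>, where both sides vanish. The step works
  because the death rate minus the birth rate at \<open>k\<close> is
  \<open>2 * n * (k - (n + 1) / 2)\<close>. Hence the edge weight in
  \<open>discrete_poincare\<close> is the birth rate times the weight of \<open>z\<close>, over
  \<open>2 * n\<close>.\<close>

lemma narayana_tail:
  assumes "1 \<le> z" "z \<le> n"
  shows "2 * real n * (\<Sum>k\<in>{z<..n}. (real k - (real n + 1) / 2) * narayana n k)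
    = (real n - real z) * (real n - real z + 1) * narayana n z"
  using assms(2,1)
proof (induction z rule: inc_induct)
  case base
  then show ?case by simp
next
  case (step z)
  have "{z<..n} = insert (Suc z) {Suc z<..n}" using step by auto
  then have "2 * real n * (\<Sum>k\<in>{z<..n}. (real k - (real n + 1) / 2) * narayana n k)
    = 2 * real n * (real (Suc z) - (real n + 1) / 2) * narayana n (Suc z)
      + (real n - real (Suc z)) * (real n - real (Suc z) + 1) * narayana n (Suc z)"
    using step by (simp add: distrib_left)
  also have "\<dots> = narayana n (Suc z) * (real z * (real z + 1))"
    by (simp add: field_simps)
  finally show ?case using narayana_Suc[of z n] step by (simp add: mult.commute)
qed

text \<open>The term \<open>k = 1\<close> cancels the tail sum at \<open>z = 1\<close>, because the
  death rate at 1 is 0.\<close>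

lemma narayana_mean:
  assumes "n \<ge> 1"
  shows "(\<Sum>k\<in>{1..n}. real k * narayana n k) = (real n + 1) / 2 * catalan n"
proof -
  have "{1..n} = insert 1 {1<..n}" using assms by auto
  then have "2 * real n * (\<Sum>k\<in>{1..n}. (real k - (real n + 1) / 2) * narayana n k)
    = 2 * real n * (1 - (real n + 1) / 2) * narayana n 1
      + (real n - 1) * (real n - 1 + 1) * narayana n 1"
    using narayana_tail[of 1 n] assms by (simp add: distrib_left)
  also have "\<dots> = 0" by (simp add: field_simps)
  finally have "(\<Sum>k\<in>{1..n}. (real k - (real n + 1) / 2) * narayana n k) = 0" using assms by simp
  then show ?thesis using sum_narayana[OF assms]
    by (simp only: left_diff_distrib sum_subtractf sum_distrib_left[symmetric])
qed

section \<open>From total variation to the Dirichlet form\<close>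

text \<open>\<open>P - Q\<close> factors into the difference and the sum of the square roots.
  Cauchy-Schwarz then leaves \<open>2 - 2 * B\<close> times \<open>2 + 2 * B\<close>, where
  \<open>B\<close> is the Bhattacharyya coefficient. Keeping the second factor makes the bound
  exactly a variance.\<close>

lemma abs_sum_diff_le_hellinger:
  fixes P Q :: "'b \<Rightarrow> real"
  assumes "finite S" "A \<subseteq> S" and P: "\<And>k. k \<in> S \<Longrightarrow> P k \<ge> 0" and Q: "\<And>k. k \<in> S \<Longrightarrow> Q k \<ge> 0"
    and P1: "sum P S = 1" and Q1: "sum Q S = 1"
  shows "(sum P A - sum Q A)\<^sup>2 \<le> 1 - (\<Sum>k\<in>S. sqrt (P k * Q k))\<^sup>2"
proof -
  \<comment> \<open>Equal total masses make the differences over \<open>A\<close> and over its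
    complement opposite, whence the factor 2 below.\<close>
  have "sum P S = sum P A + sum P (S - A)" "sum Q S = sum Q A + sum Q (S - A)"
    using assms by (simp_all add: sum.subset_diff add.commute)
  then have "2 * \<bar>sum P A - sum Q A\<bar> = \<bar>\<Sum>k\<in>A. P k - Q k\<bar> + \<bar>\<Sum>k\<in>S-A. P k - Q k\<bar>"
    using P1 Q1 by (simp add: sum_subtractf)
  also have "\<dots> \<le> (\<Sum>k\<in>A. \<bar>P k - Q k\<bar>) + (\<Sum>k\<in>S-A. \<bar>P k - Q k\<bar>)"
    by (intro add_mono sum_abs)
  also have "\<dots> = (\<Sum>k\<in>S. \<bar>P k - Q k\<bar>)"
    using assms by (simp add: sum.subset_diff add.commute)
  finally have le: "2 * \<bar>sum P A - sum Q A\<bar> \<le> (\<Sum>k\<in>S. \<bar>P k - Q k\<bar>)" .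
  define B where "B = (\<Sum>k\<in>S. sqrt (P k * Q k))"
  have a: "\<bar>P k - Q k\<bar> = \<bar>sqrt (P k) - sqrt (Q k)\<bar> * (sqrt (P k) + sqrt (Q k))" if "k \<in> S" for k
  proof -
    have "P k - Q k = (sqrt (P k) - sqrt (Q k)) * (sqrt (P k) + sqrt (Q k))"
      using P[OF that] Q[OF that] by (simp add: algebra_simps)
    then show ?thesis using P[OF that] Q[OF that] by (simp add: abs_mult)
  qed
  have "(2 * \<bar>sum P A - sum Q A\<bar>)\<^sup>2 \<le> (\<Sum>k\<in>S. \<bar>P k - Q k\<bar>)\<^sup>2"
    using le by (intro power_mono) auto
  also have "\<dots> = (\<Sum>k\<in>S. \<bar>sqrt (P k) - sqrt (Q k)\<bar> * (sqrt (P k) + sqrt (Q k)))\<^sup>2"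
    using a by simp
  also have "\<dots> \<le> (\<Sum>k\<in>S. \<bar>sqrt (P k) - sqrt (Q k)\<bar>\<^sup>2) * (\<Sum>k\<in>S. (sqrt (P k) + sqrt (Q k))\<^sup>2)"
    by (rule Cauchy_Schwarz_ineq_sum)
  also have "(\<Sum>k\<in>S. \<bar>sqrt (P k) - sqrt (Q k)\<bar>\<^sup>2) = (\<Sum>k\<in>S. P k + Q k - 2 * sqrt (P k * Q k))"
    using P Q by (intro sum.cong) (auto simp: power2_eq_square algebra_simps real_sqrt_mult)
  also have "\<dots> = 2 - 2 * B"
    by (simp add: sum.distrib sum_subtractf P1 Q1 B_def sum_distrib_left)
  also have "(\<Sum>k\<in>S. (sqrt (P k) + sqrt (Q k))\<^sup>2) = (\<Sum>k\<in>S. P k + Q k + 2 * sqrt (P k * Q k))"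
    using P Q by (intro sum.cong) (auto simp: power2_eq_square algebra_simps real_sqrt_mult)
  also have "\<dots> = 2 + 2 * B"
    by (simp add: sum.distrib P1 Q1 B_def sum_distrib_left)
  finally show ?thesis by (simp add: B_def[symmetric] power2_eq_square algebra_simps)
qed

text \<open>\<open>1 - B^2\<close> is the variance of \<open>g = sqrt (Q / P)\<close> under
  \<open>P\<close>, so the Poincare inequality applies. Multiplying the increments of
  \<open>g\<close> by the edge weight removes \<open>P\<close>, so that the right side contains only
  \<open>Q\<close> and the rates.\<close>

lemma narayana_tv_dirichlet:
  fixes Q :: "nat \<Rightarrow> real"
  assumes n: "n \<ge> 1" and Q: "\<And>k. Q k \<ge> 0" and Q1: "(\<Sum>k\<in>{1..n}. Q k) = 1" and A: "A \<subseteq> {1..n}"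
  shows "((\<Sum>k\<in>A. narayana n k / catalan n) - (\<Sum>k\<in>A. Q k))\<^sup>2
    \<le> (\<Sum>z\<in>{1..<n}. (sqrt (real z * (real z + 1) * Q (Suc z))
         - sqrt ((real n - real z) * (real n - real z + 1) * Q z))\<^sup>2) / (2 * real n)"
proof -
  define P where "P k = narayana n k / catalan n" for k
  define g where "g k = sqrt (Q k / P k)" for k
  define B where "B = (\<Sum>k\<in>{1..n}. sqrt (P k * Q k))"
  have P: "P k \<ge> 0" for k using narayana_nonneg catalan_pos[of n] by (simp add: P_def)
  have Pp: "P k > 0" if "k \<in> {1..n}" for k
    using that narayana_pos[of k n] catalan_pos[of n] by (simp add: P_def)
  have P1: "(\<Sum>k\<in>{1..n}. P k) = 1"
    using sum_narayana[OF n] catalan_pos[of n] by (simp add: P_def sum_divide_distrib[symmetric])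
  have mean: "(\<Sum>k\<in>{1..n}. real k * P k) = (real n + 1) / 2"
    using narayana_mean[OF n] catalan_pos[of n] by (simp add: P_def sum_divide_distrib[symmetric])
  have Pg: "P k * (g k)\<^sup>2 = Q k" "P k * g k = sqrt (P k * Q k)" if "k \<in> {1..n}" for k
    using Pp[OF that] Q[of k] by (simp_all add: g_def real_sqrt_mult real_sqrt_divide field_simps)
  have "(sum P A - sum Q A)\<^sup>2 \<le> 1 - B\<^sup>2"
    unfolding B_def by (rule abs_sum_diff_le_hellinger[OF _ A]) (use P1 Q1 in \<open>auto simp: P Q\<close>)
  \<comment> \<open>Inserting the total masses, both 1, makes this a double sum; its diagonal terms
    vanish.\<close>
  also have "1 - B\<^sup>2 = (\<Sum>x\<in>{1..n}. P x) * (\<Sum>y\<in>{1..n}. Q y)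
      - (\<Sum>x\<in>{1..n}. sqrt (P x * Q x)) * (\<Sum>y\<in>{1..n}. sqrt (P y * Q y))"
    by (simp add: P1 Q1 B_def power2_eq_square del: One_nat_def)
  also have "\<dots> = (\<Sum>x\<in>{1..n}. \<Sum>y\<in>{1..n}. P x * Q y - sqrt (P x * Q x) * sqrt (P y * Q y))"
    unfolding sum_product sum_subtractf ..
  also have "\<dots> = (\<Sum>x\<in>{1..n}. \<Sum>y\<in>{1..n}. if x \<noteq> y then P x * P y * (g y * (g y - g x)) else 0)"
  proof (intro sum.cong refl)
    fix x y assume xy: "x \<in> {1..n}" "y \<in> {1..n}"
    have "P x * Q y - sqrt (P x * Q x) * sqrt (P y * Q y) = P x * P y * (g y * (g y - g x))"
      unfolding Pg(2)[OF xy(1), symmetric] Pg(2)[OF xy(2), symmetric]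
      unfolding Pg(1)[OF xy(2), symmetric]
      by (simp add: power2_eq_square algebra_simps)
    then show "P x * Q y - sqrt (P x * Q x) * sqrt (P y * Q y)
      = (if x \<noteq> y then P x * P y * (g y * (g y - g x)) else 0)"
      by auto
  qed
  \<comment> \<open>The terms for \<open>(x, y)\<close> and \<open>(y, x)\<close> add up to a
    square.\<close>
  also have "\<dots> = (\<Sum>x\<in>{1..n}. \<Sum>y\<in>{1..n}. if x < y then P x * P y * (g y - g x)\<^sup>2 else 0)"
    unfolding sum_pairs_less[symmetric]
    by (intro sum.cong refl) (auto simp: power2_eq_square algebra_simps)
  also have "\<dots> \<le> (\<Sum>z\<in>{1..<n}. (\<Sum>y\<in>{z<..n}. (real y - (real n + 1) / 2) * P y) * (g (Suc z) - g z)\<^sup>2)"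
    by (rule discrete_poincare[OF P P1 mean])
  also have "\<dots> = (\<Sum>z\<in>{1..<n}. (sqrt (real z * (real z + 1) * Q (Suc z))
         - sqrt ((real n - real z) * (real n - real z + 1) * Q z))\<^sup>2 / (2 * real n))"
  proof (intro sum.cong refl)
    fix z assume z: "z \<in> {1..<n}"
    define l where "l = (real n - real z) * (real n - real z + 1)"
    define u where "u = real z * (real z + 1)"
    have nonneg: "l \<ge> 0" "u \<ge> 0" using z by (auto simp: l_def u_def)
    have rev: "P z * l = P (Suc z) * u"
      using narayana_Suc[of z n] z by (simp add: P_def l_def u_def)
    have kern: "(\<Sum>y\<in>{z<..n}. (real y - (real n + 1) / 2) * P y) = l * P z / (2 * real n)"
    proof -
      define R where "R = (\<Sum>y\<in>{z<..n}. (real y - (real n + 1) / 2) * narayana n y)"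
      have "2 * real n * R = l * narayana n z"
        using narayana_tail[of z n] z by (simp add: R_def l_def)
      then have "R = l * narayana n z / (2 * real n)"
        using n by (simp add: eq_divide_eq mult.commute)
      moreover have "(\<Sum>y\<in>{z<..n}. (real y - (real n + 1) / 2) * P y) = R / catalan n"
        by (simp add: P_def R_def sum_divide_distrib)
      ultimately show ?thesis by (simp add: P_def)
    qed
    \<comment> \<open>Detailed balance lets the same factor \<open>sqrt (l * P z)\<close> come out
      of both square roots.\<close>
    have "sqrt (u * Q (Suc z)) = sqrt (l * P z) * g (Suc z)"
      using rev Pp[of "Suc z"] z by (simp add: g_def real_sqrt_mult[symmetric] field_simps)
    moreover have "sqrt (l * Q z) = sqrt (l * P z) * g z"
      using Pp[of z] z by (simp add: g_def real_sqrt_mult[symmetric] field_simps)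
    ultimately have "(sqrt (u * Q (Suc z)) - sqrt (l * Q z))\<^sup>2 = (sqrt (l * P z))\<^sup>2 * (g (Suc z) - g z)\<^sup>2"
      by (simp add: power_mult_distrib[symmetric] right_diff_distrib)
    also have "(sqrt (l * P z))\<^sup>2 = l * P z" using nonneg P by simp
    finally show "(\<Sum>y\<in>{z<..n}. (real y - (real n + 1) / 2) * P y) * (g (Suc z) - g z)\<^sup>2
      = (sqrt (real z * (real z + 1) * Q (Suc z))
         - sqrt ((real n - real z) * (real n - real z + 1) * Q z))\<^sup>2 / (2 * real n)"
      unfolding kern l_def u_def by simp
  qed
  finally show ?thesis by (simp add: P_def sum_divide_distrib)
qed

subsection \<open>Central moments of the binomial distribution\<close>

text \<open>A plain finite sum makes sense for every real \<open>p\<close>, so the moment identities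
  are polynomial identities with no condition on \<open>p\<close>.\<close>

definition binomial_mean :: "nat \<Rightarrow> real \<Rightarrow> (nat \<Rightarrow> real) \<Rightarrow> real" where
  "binomial_mean N p f = (\<Sum>j\<le>N. real (N choose j) * p ^ j * (1 - p) ^ (N - j) * f j)"

text \<open>Conditioning on one trial, which for the weights is Pascal's rule.\<close>

lemma binomial_mean_Suc:
  "binomial_mean (Suc N) p f = p * binomial_mean N p (\<lambda>j. f (Suc j)) + (1 - p) * binomial_mean N p f"
proof -
  have "(1 - p) * binomial_mean N p f
      = (\<Sum>j\<le>N. real (N choose j) * p ^ j * (1 - p) ^ (Suc N - j) * f j)"
    unfolding binomial_mean_def sum_distrib_left
    by (intro sum.cong refl) (simp add: Suc_diff_le)
  also have "\<dots> = (\<Sum>j\<le>Suc N. real (N choose j) * p ^ j * (1 - p) ^ (Suc N - j) * f j)"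
    by simp
  also have "\<dots> = (1 - p) ^ Suc N * f 0
      + (\<Sum>j\<le>N. real (N choose Suc j) * p ^ Suc j * (1 - p) ^ (N - j) * f (Suc j))"
    by (subst sum.atMost_Suc_shift) simp
  finally have 1: "(1 - p) * binomial_mean N p f = \<dots>" .
  have "binomial_mean (Suc N) p f = (1 - p) ^ Suc N * f 0
      + (\<Sum>j\<le>N. real (Suc N choose Suc j) * p ^ Suc j * (1 - p) ^ (N - j) * f (Suc j))"
    unfolding binomial_mean_def by (subst sum.atMost_Suc_shift) simp
  also have "(\<Sum>j\<le>N. real (Suc N choose Suc j) * p ^ Suc j * (1 - p) ^ (N - j) * f (Suc j))
     = (\<Sum>j\<le>N. real (N choose Suc j) * p ^ Suc j * (1 - p) ^ (N - j) * f (Suc j))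
       + p * binomial_mean N p (\<lambda>j. f (Suc j))"
    unfolding binomial_mean_def sum_distrib_left sum.distrib[symmetric]
    by (intro sum.cong refl) (simp add: algebra_simps)
  finally show ?thesis using 1 by simp
qed

lemma binomial_mean_cmult: "binomial_mean N p (\<lambda>j. c * f j) = c * binomial_mean N p f"
  by (simp add: binomial_mean_def sum_distrib_left algebra_simps)

lemma binomial_mean_sum:
  "binomial_mean N p (\<lambda>j. \<Sum>i\<in>I. f i j) = (\<Sum>i\<in>I. binomial_mean N p (f i))"
  unfolding binomial_mean_def sum_distrib_left by (rule sum.swap)

definition binomial_moment :: "nat \<Rightarrow> nat \<Rightarrow> real \<Rightarrow> real" where
  "binomial_moment k N p = binomial_mean N p (\<lambda>j. (real j - real N * p) ^ k)"

lemma binomial_mean_shifted_power: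
  "binomial_mean N p (\<lambda>j. (real j - real N * p + c) ^ k)
    = (\<Sum>i\<le>k. real (k choose i) * c ^ (k - i) * binomial_moment i N p)"
  unfolding binomial_ring binomial_mean_sum binomial_moment_def binomial_mean_cmult[symmetric]
  by (simp add: mult_ac)

text \<open>A success moves the centred count by \<open>1 - p\<close>, a failure by
  \<open>- p\<close>; the bracket is the central moment of order \<open>k - i\<close> of one
  trial.\<close>

lemma binomial_moment_Suc:
  "binomial_moment k (Suc N) p = (\<Sum>i\<le>k. real (k choose i)
     * (p * (1 - p) ^ (k - i) + (1 - p) * (- p) ^ (k - i)) * binomial_moment i N p)"
proof -
  have "binomial_moment k (Suc N) p
      = p * binomial_mean N p (\<lambda>j. (real j - real N * p + (1 - p)) ^ k)
        + (1 - p) * binomial_mean N p (\<lambda>j. (real j - real N * p + (- p)) ^ k)"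
    unfolding binomial_moment_def binomial_mean_Suc by (simp add: algebra_simps)
  then show ?thesis
    by (simp only: binomial_mean_shifted_power sum_distrib_left sum.distrib[symmetric])
       (simp add: algebra_simps)
qed

lemma binomial_moment_0_trials: "binomial_moment k 0 p = (if k = 0 then 1 else 0)"
  by (simp add: binomial_moment_def binomial_mean_def)

lemma binomial_moment_0: "binomial_moment 0 N p = 1"
  by (induction N) (simp_all add: binomial_moment_0_trials binomial_moment_Suc)

lemma binomial_moment_1: "binomial_moment 1 N p = 0"
  by (induction N) (simp_all add: binomial_moment_0_trials binomial_moment_Suc binomial_moment_0)

lemmas binomial_moment_expand = numeral_eq_Suc binomial_moment_0 binomial_moment_1[unfolded One_nat_def]

text \<open>This and the closed forms of orders 3 to 6 follow by induction on the number of trials: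
  one more trial adds a polynomial in lower moments, and the moment of order 1 is 0.\<close>

lemma binomial_moment_2: "binomial_moment 2 N p = N * (p * (1 - p))"
proof (induction N)
  case (Suc N)
  have "binomial_moment 2 (Suc N) p = p * (1 - p)^2 + (1 - p) * p^2 + binomial_moment 2 N p"
    unfolding binomial_moment_Suc by (simp add: binomial_moment_expand)
  then show ?case unfolding Suc.IH by (simp add: algebra_simps power2_eq_square)
qed (simp add: binomial_moment_0_trials)

lemma binomial_moment_3: "binomial_moment 3 N p = N * (p * (1 - p) * (1 - 2 * p))"
proof (induction N)
  case (Suc N)
  have "binomial_moment 3 (Suc N) p = p * (1 - p)^3 - (1 - p) * p^3 + binomial_moment 3 N p"
    unfolding binomial_moment_Suc by (simp add: binomial_moment_expand)
  then show ?case unfolding Suc.IH of_nat_Suc by algebra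
qed (simp add: binomial_moment_0_trials)

lemma binomial_moment_4:
  "binomial_moment 4 N p = 3 * (N * (p * (1 - p)))^2 + N * (p * (1 - p)) * (1 - 6 * (p * (1 - p)))"
proof (induction N)
  case (Suc N)
  have "binomial_moment 4 (Suc N) p = p * (1 - p)^4 + (1 - p) * p^4
      + 6 * (p * (1 - p)^2 + (1 - p) * p^2) * binomial_moment 2 N p + binomial_moment 4 N p"
    unfolding binomial_moment_Suc by (simp add: binomial_moment_expand)
  then show ?case unfolding Suc.IH of_nat_Suc binomial_moment_2 by algebra
qed (simp add: binomial_moment_0_trials)

lemma binomial_moment_5:
  "binomial_moment 5 N p
    = N * (p * (1 - p)) * (1 - 2 * p) * (1 - 12 * (p * (1 - p)) + 10 * N * (p * (1 - p)))"
proof (induction N)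
  case (Suc N)
  have "binomial_moment 5 (Suc N) p = p * (1 - p)^5 - (1 - p) * p^5
      + 10 * (p * (1 - p)^3 - (1 - p) * p^3) * binomial_moment 2 N p
      + 10 * (p * (1 - p)^2 + (1 - p) * p^2) * binomial_moment 3 N p + binomial_moment 5 N p"
    unfolding binomial_moment_Suc by (simp add: binomial_moment_expand)
  then show ?case unfolding Suc.IH of_nat_Suc binomial_moment_2 binomial_moment_3 by algebra
qed (simp add: binomial_moment_0_trials)

lemma binomial_moment_6:
  "binomial_moment 6 N p = 15 * (N * (p * (1 - p)))^3
     + 5 * (N * (p * (1 - p)))^2 * (5 - 26 * (p * (1 - p)))
     + N * (p * (1 - p)) * (1 - 30 * (p * (1 - p)) + 120 * (p * (1 - p))^2)"
proof (induction N)
  case (Suc N)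
  have "binomial_moment 6 (Suc N) p = p * (1 - p)^6 + (1 - p) * p^6
      + 15 * (p * (1 - p)^4 + (1 - p) * p^4) * binomial_moment 2 N p
      + 20 * (p * (1 - p)^3 - (1 - p) * p^3) * binomial_moment 3 N p
      + 15 * (p * (1 - p)^2 + (1 - p) * p^2) * binomial_moment 4 N p + binomial_moment 6 N p"
    unfolding binomial_moment_Suc by (simp add: binomial_moment_expand)
  then show ?case
    unfolding Suc.IH of_nat_Suc binomial_moment_2 binomial_moment_3 binomial_moment_4 by algebra
qed (simp add: binomial_moment_0_trials)

subsection \<open>The Dirichlet form of a shifted binomial distribution\<close>

lemma binomial_mean_cubic_sq:
  "binomial_mean N p (\<lambda>j. (a * (f j)^2 + b * f j - c - (f j)^3)^2)
    = binomial_mean N p (\<lambda>j. f j ^ 6) - 2 * a * binomial_mean N p (\<lambda>j. f j ^ 5)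
      + (a^2 - 2 * b) * binomial_mean N p (\<lambda>j. f j ^ 4)
      + (2 * c + 2 * a * b) * binomial_mean N p (\<lambda>j. f j ^ 3)
      + (b^2 - 2 * a * c) * binomial_mean N p (\<lambda>j. f j ^ 2)
      - 2 * b * c * binomial_mean N p (\<lambda>j. f j ^ 1) + c^2 * binomial_mean N p (\<lambda>j. 1)"
proof -
  have "(a * (f j)^2 + b * f j - c - (f j)^3)^2
    = f j ^ 6 + (- 2 * a) * f j ^ 5 + (a^2 - 2 * b) * f j ^ 4 + (2 * c + 2 * a * b) * f j ^ 3
      + (b^2 - 2 * a * c) * f j ^ 2 + (- 2 * b * c) * f j ^ 1 + c^2 * 1" for j
    by (simp add: numeral_eq_Suc algebra_simps)
  moreover have add: "binomial_mean N p (\<lambda>j. g j + h j) = binomial_mean N p g + binomial_mean N p h"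
    for g h by (simp add: binomial_mean_def sum.distrib algebra_simps)
  ultimately show ?thesis by (simp only: add binomial_mean_cmult)
qed

text \<open>For \<open>T\<close> trials with \<open>c = p * (1 - p)\<close>, the left side collects
  the terms of the sixth moment about \<open>T * p + t\<close> that come from even central moments.
  The cubic term alone gives the bound since \<open>c \<le> 1 / 4\<close>; the rest is nonpositive
  in total.\<close>

lemma sixth_moment_le:
  fixes T c t :: real
  assumes c: "c = 1 / 4 - t\<^sup>2" and t: "0 \<le> t" "t \<le> 1 / 14" and T: "T \<ge> 8"
  shows "(15 * (T * c)^3 + 5 * (T * c)^2 * (5 - 26 * c) + T * c * (1 - 30 * c + 120 * c^2))
      + 15 * t^2 * (3 * (T * c)^2 + T * c * (1 - 6 * c)) + 15 * t^4 * (T * c) + t^6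
    \<le> 15 / 64 * T^3"
proof -
  have t2: "0 \<le> t\<^sup>2" "t\<^sup>2 \<le> 1 / 196"
    using t power_mono[of t "1/14" 2] by (auto simp: power2_eq_square)
  have t4: "t ^ 4 \<le> 1 / 196" "t ^ 6 \<le> 1 / 196"
  proof -
    have "t ^ 4 \<le> t ^ 2" "t ^ 6 \<le> t ^ 2" using t by (intro power_decreasing; simp)+
    then show "t ^ 4 \<le> 1 / 196" "t ^ 6 \<le> 1 / 196" using t2 by auto
  qed
  have c1: "c \<le> 1 / 4" "12 / 49 \<le> c" using c t2 by auto
  define X where "X = T * c"
  have X: "X \<ge> 8 * (12 / 49)" "X \<le> T / 4"
    unfolding X_def using c1 T mult_mono[of 8 T "12/49" c] mult_left_mono[of c "1/4" T] by auto
  have "X ^ 3 \<le> (T / 4) ^ 3" using X by (intro power_mono) auto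
  then have X3: "15 * X ^ 3 \<le> 15 / 64 * T ^ 3" by (simp add: power_divide)
  \<comment> \<open>As \<open>c\<close> is at least \<open>1 / 4 - 1 / 196 = 12 / 49\<close>, this
    quadratic term is negative; with \<open>X\<close> bounded below it outweighs all remaining
    positive terms.\<close>
  have "5 * X\<^sup>2 * (5 - 26 * c) \<le> 5 * X\<^sup>2 * (- 67 / 49)"
    using c1 by (intro mult_left_mono) auto
  moreover have "c\<^sup>2 \<le> c * (1 / 4)" unfolding power2_eq_square using c1 by (intro mult_left_mono) auto
  then have "1 - 30 * c + 120 * c\<^sup>2 \<le> 1" by linarith
  then have "X * (1 - 30 * c + 120 * c\<^sup>2) \<le> X * 1"
    using X by (intro mult_left_mono) auto
  moreover have "3 * X\<^sup>2 + X * (1 - 6 * c) \<le> 3 * X\<^sup>2"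
    using X c1 by (simp add: mult_nonneg_nonpos)
  then have "15 * t\<^sup>2 * (3 * X\<^sup>2 + X * (1 - 6 * c)) \<le> 15 * t\<^sup>2 * (3 * X\<^sup>2)"
    using t2 by (intro mult_left_mono) auto
  moreover have "15 * t\<^sup>2 * (3 * X\<^sup>2) \<le> 15 * (1 / 196) * (3 * X\<^sup>2)"
    using t2 by (intro mult_right_mono) auto
  moreover have "15 * t ^ 4 * X \<le> 15 * (1 / 196) * X"
    using t4 X by (intro mult_right_mono) auto
  moreover have "X\<^sup>2 \<ge> X * (8 * (12 / 49))"
    unfolding power2_eq_square using X by (intro mult_left_mono) auto
  ultimately show ?thesis unfolding X_def[symmetric] using X3 X t4 by linarith
qed

text \<open>Expanding the square gives moments about \<open>N * p + t\<close>. Order 6 yields the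
  cubic term of the bound and order 2 the term in \<open>b^2\<close>; the mean \<open>- t\<close> of
  the deviation produces \<open>2 * b * c * t\<close>.\<close>

lemma binomial_mean_cubic_sq_le:
  fixes a b c t :: real
  assumes p: "p = 1 / 2 - t" and t: "0 \<le> t" "t \<le> 1 / 14" and N: "N \<ge> 8"
    and a: "0 \<le> a" "a \<le> 2" and b: "2 \<le> b" and c: "0 \<le> c"
  shows "binomial_mean N p (\<lambda>j. (a * (real j - N * p - t)^2 + b * (real j - N * p - t) - c
            - (real j - N * p - t)^3)^2)
       \<le> 15 / 64 * real N ^ 3 + b^2 * (N / 4) + 2 * b * c * t + c^2"
proof -
  define s where "s = p * (1 - p)"
  define X where "X = real N * s"
  define W where "W k = binomial_mean N p (\<lambda>j. (real j - N * p - t) ^ k)" for k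
  have s: "s = 1 / 4 - t\<^sup>2" by (simp add: s_def p power2_eq_square algebra_simps)
  have q: "1 - 2 * p = 2 * t" by (simp add: p)
  have t2: "0 \<le> t\<^sup>2" "t\<^sup>2 \<le> 1 / 196"
    using t power_mono[of t "1/14" 2] by (auto simp: power2_eq_square)
  have s1: "s \<le> 1 / 4" "12 / 49 \<le> s" using s t2 by auto
  have X: "X \<ge> 8 * (12 / 49)" "X \<le> N / 4"
    unfolding X_def using s1 N mult_mono[of 8 "real N" "12/49" s] mult_left_mono[of s "1/4" N] by auto
  have W: "W k = (\<Sum>i\<le>k. real (k choose i) * (- t) ^ (k - i) * binomial_moment i N p)" for k
    using binomial_mean_shifted_power[of N p "- t" k] by (simp add: W_def)
  have m: "binomial_moment 2 N p = X" "binomial_moment 3 N p = 2 * t * X"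
    "binomial_moment 4 N p = 3 * X\<^sup>2 + X * (1 - 6 * s)"
    "binomial_moment 5 N p = 2 * t * X * (1 - 12 * s + 10 * X)"
    "binomial_moment 6 N p = 15 * X^3 + 5 * X^2 * (5 - 26 * s) + X * (1 - 30 * s + 120 * s\<^sup>2)"
    unfolding binomial_moment_2 binomial_moment_3 binomial_moment_4 binomial_moment_5
      binomial_moment_6 q s_def[symmetric] X_def by (simp_all add: algebra_simps)
  have W0: "binomial_mean N p (\<lambda>j. 1) = 1"
    using binomial_moment_0[of N p] by (simp add: binomial_moment_def)
  have W1: "W 1 = - t"
    unfolding W by (simp add: binomial_moment_expand)
  have "W 2 = binomial_moment 2 N p + t\<^sup>2"
    unfolding W by (simp add: binomial_moment_expand)
  then have "W 2 = N / 4 - N * t\<^sup>2 + t\<^sup>2" by (simp add: m X_def s algebra_simps)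
  then have W2: "W 2 \<le> N / 4" using mult_right_mono[of 1 "real N" "t\<^sup>2"] N by simp
  \<comment> \<open>Recentring by \<open>t\<close> turns the third central moment
    \<open>2 * t * X\<close> into \<open>- (t * X) - t ^ 3\<close>, hence the sign; for order 5 the
    leading term \<open>5 * t * X^2\<close> stays positive.\<close>
  have "W 3 = binomial_moment 3 N p - 3 * t * binomial_moment 2 N p - t ^ 3"
    unfolding W by (simp add: binomial_moment_expand)
  then have "W 3 = - (t * X) - t ^ 3" by (simp add: m)
  then have W3: "W 3 \<le> 0" using t X mult_nonneg_nonneg[of t X] zero_le_power[of t 3] by linarith
  have W4: "W 4 \<ge> 0"
    unfolding W_def binomial_mean_def using t p by (intro sum_nonneg mult_nonneg_nonneg) auto
  have "W 5 = binomial_moment 5 N p - 5 * t * binomial_moment 4 N p + 10 * t\<^sup>2 * binomial_moment 3 N p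
      - 10 * t ^ 3 * binomial_moment 2 N p - t ^ 5"
    unfolding W by (simp add: binomial_moment_expand)
  also have "\<dots> = t * (X * (5 * X - 3 + 6 * s + 10 * t\<^sup>2) - t ^ 4)"
    unfolding m by algebra
  finally have W5: "W 5 = \<dots>" .
  have "t ^ 4 \<le> 1" using t by (intro power_le_one) auto
  moreover have "1 \<le> 5 * X - 3 + 6 * s + 10 * t\<^sup>2"
    using X s1 t2 by linarith
  then have "1 * 1 \<le> X * (5 * X - 3 + 6 * s + 10 * t\<^sup>2)"
    using X by (intro mult_mono) auto
  ultimately have W5: "W 5 \<ge> 0" unfolding W5 using t by (intro mult_nonneg_nonneg) auto
  have "W 6 = binomial_moment 6 N p - 6 * t * binomial_moment 5 N p + 15 * t^2 * binomial_moment 4 N p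
      - 20 * t^3 * binomial_moment 3 N p + 15 * t^4 * binomial_moment 2 N p + t^6"
    unfolding W by (simp add: binomial_moment_expand)
  moreover have "t * binomial_moment 5 N p \<ge> 0" "t ^ 3 * binomial_moment 3 N p \<ge> 0"
    unfolding m using t X s1 by (auto intro!: mult_nonneg_nonneg)
  ultimately have "W 6 \<le> binomial_moment 6 N p + 15 * t^2 * binomial_moment 4 N p
      + 15 * t^4 * binomial_moment 2 N p + t^6"
    by (simp add: mult.assoc)
  also have "\<dots> \<le> 15 / 64 * real N ^ 3"
    unfolding m X_def using sixth_moment_le[OF s t, of "real N"] N by simp
  finally have W6: "W 6 \<le> 15 / 64 * real N ^ 3" .
  \<comment> \<open>\<open>W 3 \<le> 0 \<le> W 5\<close> and \<open>a\<^sup>2 \<le> 2 b\<close>, so the terms of orders 3, 4 and 5 can be dropped.\<close>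
  have "a\<^sup>2 \<le> 2 * b" using a b mult_mono[of a 2 a 2] by (simp add: power2_eq_square)
  then have W4': "(a^2 - 2 * b) * W 4 \<le> 0" using W4 by (intro mult_nonpos_nonneg) auto
  have W5': "2 * a * W 5 \<ge> 0" using a W5 by simp
  have W3': "(2 * c + 2 * a * b) * W 3 \<le> 0" using a b c W3 by (intro mult_nonneg_nonpos) auto
  have W2': "(b^2 - 2 * a * c) * W 2 \<le> b^2 * (N / 4)"
  proof -
    have "W 2 \<ge> 0"
      unfolding W_def binomial_mean_def using t p by (intro sum_nonneg mult_nonneg_nonneg) auto
    then have "(b^2 - 2 * a * c) * W 2 \<le> b^2 * W 2" using a c by (intro mult_right_mono) auto
    also have "\<dots> \<le> b^2 * (N / 4)" using W2 by (intro mult_left_mono) auto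
    finally show ?thesis .
  qed
  show ?thesis
    unfolding binomial_mean_cubic_sq W_def[symmetric] W0 W1
    using W2' W3' W4' W5' W6 by simp
qed

section \<open>Reduction of the Dirichlet form to the squared cubic\<close>

text \<open>Difference of squares, with \<open>(sqrt x + sqrt y)^2\<close> at least
  \<open>x + y\<close>. A uniform \<open>h\<close> trades the square roots for polynomials over one
  common denominator.\<close>

lemma sqrt_diff_sq_le:
  fixes x y h :: real
  assumes "0 \<le> x" "0 \<le> y" "0 < h" "h \<le> x + y"
  shows "(sqrt x - sqrt y)\<^sup>2 \<le> (x - y)\<^sup>2 / h"
proof -
  have "(sqrt x + sqrt y)\<^sup>2 = x + y + 2 * (sqrt x * sqrt y)"
    using assms by (simp add: power2_sum)
  moreover have "0 \<le> sqrt x * sqrt y" using assms by simp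
  ultimately have "h \<le> (sqrt x + sqrt y)\<^sup>2" using assms by linarith
  then have "(sqrt x - sqrt y)\<^sup>2 * h \<le> (sqrt x - sqrt y)\<^sup>2 * (sqrt x + sqrt y)\<^sup>2"
    by (intro mult_left_mono) auto
  also have "\<dots> = ((sqrt x)\<^sup>2 - (sqrt y)\<^sup>2)\<^sup>2"
    unfolding power_mult_distrib[symmetric] by (simp add: power2_eq_square algebra_simps)
  also have "\<dots> = (x - y)\<^sup>2" using assms by simp
  finally show ?thesis using assms by (simp add: pos_le_divide_eq)
qed

text \<open>Two neighbouring weights for \<open>N\<close> trials become linear multiples of one
  weight for \<open>N + 1\<close> trials, so each Dirichlet term carries a single binomial weight.
  The value 0 at \<open>J = 0\<close> stands for the weight at -1.\<close>

lemma binomial_absorb_ratio: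
  fixes p :: real
  assumes p: "0 < p" "p < 1" and J: "J \<le> Suc N"
  defines "B \<equiv> real (Suc N choose J) * p ^ J * (1 - p) ^ (Suc N - J)"
  shows "real (N choose J) * p ^ J * (1 - p) ^ (N - J)
      = B * ((real (Suc N) - real J) * p) / (real (Suc N) * (p * (1 - p)))" (is ?thesis1)
    and "(if J = 0 then 0 else real (N choose (J - 1)) * p ^ (J - 1) * (1 - p) ^ (N - (J - 1)))
      = B * (real J * (1 - p)) / (real (Suc N) * (p * (1 - p)))" (is ?thesis2)
proof -
  show ?thesis1
  proof (cases "J = Suc N")
    case False
    then have J': "J \<le> N" using J by simp
    have "(Suc N - J) * (Suc N choose J) = Suc N * (N choose J)"
      using binomial_absorb_comp[of "Suc N" J] by simp
    then have "real (Suc N - J) * real (Suc N choose J) = real (Suc N) * real (N choose J)"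
      by (metis of_nat_mult)
    then have "(real (Suc N) - real J) * real (Suc N choose J) = real (Suc N) * real (N choose J)"
      using J by (simp add: of_nat_diff)
    moreover have "B * ((real (Suc N) - real J) * p)
      = ((real (Suc N) - real J) * real (Suc N choose J)) * p ^ J * (p * (1 - p)) * (1 - p) ^ (N - J)"
      using J' by (simp add: B_def Suc_diff_le mult_ac del: of_nat_Suc binomial_Suc_Suc)
    ultimately have "B * ((real (Suc N) - real J) * p)
      = (real (Suc N) * real (N choose J)) * p ^ J * (p * (1 - p)) * (1 - p) ^ (N - J)"
      by simp
    moreover have "real (Suc N) * (p * (1 - p)) \<noteq> 0" using p by simp
    ultimately show ?thesis by (simp add: eq_divide_eq mult_ac del: of_nat_Suc)
  qed (simp add: B_def)
  show ?thesis2
  proof (cases J)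
    case (Suc j)
    have "Suc j * (Suc N choose Suc j) = Suc N * (N choose j)"
      using binomial_absorption[of j "Suc N"] by simp
    then have "real (Suc j) * real (Suc N choose Suc j) = real (Suc N) * real (N choose j)"
      by (metis of_nat_mult)
    then have "B * (real J * (1 - p))
      = (real (Suc N) * real (N choose j)) * p ^ j * (p * (1 - p)) * (1 - p) ^ (N - j)"
      using Suc by (simp add: B_def mult_ac del: of_nat_Suc binomial_Suc_Suc)
    moreover have "real (Suc N) * (p * (1 - p)) \<noteq> 0" using p by simp
    ultimately show ?thesis by (simp add: Suc eq_divide_eq mult_ac del: of_nat_Suc)
  qed simp
qed

text \<open>The death rate \<open>k (k + 1)\<close> at \<open>k + 1\<close> and the birth rate
  \<open>(n - k) (n - k + 1)\<close> at \<open>k\<close>, weighted by the binomial law, with \<open>k = n/2 + w\<close>. The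
  coefficient of \<open>w\<close> on the right is only of order \<open>n\<close> when \<open>N\<close> is close to \<open>n/2\<close>.\<close>

lemma drift_difference:
  fixes n N w t :: real
  shows "(n / 2 + w) * (n / 2 + w + 1) * (((N + 1) / 2 - w + N * t) * (1 / 2 - t))
      - (n / 2 - w) * (n / 2 - w + 1) * (((N + 1) / 2 + w - N * t) * (1 / 2 + t))
    = t * (2 * n + 1) * w\<^sup>2
      + ((n + 1) * (N + 1) / 2 - n\<^sup>2 / 4 - n / 2 - 2 * t * (n + 1) * (N * t)) * w
      - t * (n\<^sup>2 / 4 + n / 2) - w ^ 3"
  by (simp add: field_simps power2_eq_square power3_eq_cube)

text \<open>\<open>T\<close> is close to \<open>n / 2\<close>, so the numerator has order
  \<open>n^3\<close> and the denominator order \<open>n^4\<close>. The constant is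
  \<open>288 = 2 * 12^2\<close>, as the final bound requires after division by
  \<open>2 * n\<close>.\<close>

lemma cubic_bound_div_le:
  fixes n T b c t p :: real
  assumes n: "n \<ge> 13" and T: "(n + 3) / 2 \<le> T" "T \<le> (n + 4) / 2"
    and b: "0 \<le> b" "b \<le> 3 * n / 4 + 1" and c: "0 \<le> c" "c \<le> (n + 1) / 4"
    and t: "0 \<le> t" "t \<le> 1 / 14" "t * (n + 1) \<le> 1" and p: "p = 1 / 2 - t"
  shows "(15 / 64 * T ^ 3 + b\<^sup>2 * (T / 4) + 2 * b * c * t + c\<^sup>2)
      / (T * (p * (1 - p)) * (T * p * ((n / 4 - 3 / 2) * (n / 4 - 1 / 2)))) \<le> 288 / n"
proof -
  \<comment> \<open>The numerator is at most \<open>T * A\<close>; the summands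
    \<open>(n + 1) / 8 + 3 / 4\<close> absorb \<open>c^2\<close> and
    \<open>2 * b * c * t\<close>.\<close>
  define A where "A = 15 / 64 * ((n + 4) / 2)\<^sup>2 + (3 * n / 4 + 1)\<^sup>2 / 4 + (n + 1) / 8 + 3 / 4"
  define R where "R = (n / 4 - 3 / 2) * (n / 4 - 1 / 2)"
  have R: "R > 0" unfolding R_def using n by (intro mult_pos_pos) auto
  have "c * t \<le> (n + 1) / 4 * t" using c t by (intro mult_right_mono) auto
  then have "c * t \<le> 1 / 4" using t by (simp add: algebra_simps)
  then have "2 * b * (c * t) \<le> 2 * (3 * n / 4 + 1) * (1 / 4)"
    using b c t by (intro mult_mono) auto
  moreover have "c\<^sup>2 \<le> ((n + 1) / 4)\<^sup>2" using c by (intro power_mono) auto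
  moreover have "T * (3 * n / 4 + 1)\<^sup>2 / 4 \<ge> b\<^sup>2 * (T / 4)"
  proof -
    have "b\<^sup>2 \<le> (3 * n / 4 + 1)\<^sup>2" using b by (intro power_mono) auto
    then show ?thesis using T n mult_right_mono[of "b\<^sup>2" "(3 * n / 4 + 1)\<^sup>2" "T / 4"]
      by (simp add: mult_ac)
  qed
  moreover have "T ^ 3 \<le> T * ((n + 4) / 2)\<^sup>2"
  proof -
    have "T\<^sup>2 \<le> ((n + 4) / 2)\<^sup>2" using T n by (intro power_mono) auto
    then show ?thesis using T n mult_left_mono[of "T\<^sup>2" "((n + 4) / 2)\<^sup>2" T]
      by (simp add: power3_eq_cube power2_eq_square)
  qed
  moreover have "((n + 1) / 4)\<^sup>2 + 2 * (3 * n / 4 + 1) * (1 / 4) \<le> T * ((n + 1) / 8 + 3 / 4)"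
  proof -
    have "((n + 1) / 4)\<^sup>2 + 2 * (3 * n / 4 + 1) * (1 / 4) \<le> (n + 3) / 2 * ((n + 1) / 8 + 3 / 4)"
      using n by (simp add: power2_eq_square field_simps)
    also have "\<dots> \<le> T * ((n + 1) / 8 + 3 / 4)" using T n by (intro mult_right_mono) auto
    finally show ?thesis .
  qed
  ultimately have num: "15 / 64 * T ^ 3 + b\<^sup>2 * (T / 4) + 2 * b * c * t + c\<^sup>2 \<le> T * A"
    unfolding A_def by (simp add: algebra_simps)
  have poly: "n * A \<le> 288 * (12 / 49 * (3 / 7)) * ((n + 3) / 2 * R)"
  proof -
    \<comment> \<open>In powers of \<open>u\<close> the inequality holds coefficient by coefficient.
      The factors \<open>12 / 49\<close> and \<open>3 / 7\<close> are the values of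
      \<open>p * (1 - p)\<close> and \<open>p\<close> at \<open>t = 1 / 14\<close>.\<close>
    define u where "u = n - 13"
    have "u \<ge> 0" "n = u + 13" using n by (auto simp: u_def)
    then show ?thesis
      unfolding A_def R_def by (simp add: power2_eq_square field_simps)
  qed
  have p1: "p \<ge> 3 / 7" "p * (1 - p) \<ge> 12 / 49"
  proof -
    show "p \<ge> 3 / 7" using p t by simp
    have "t * t \<le> 1 / 14 * (1 / 14)" using t by (intro mult_mono) auto
    then show "p * (1 - p) \<ge> 12 / 49" by (simp add: p algebra_simps)
  qed
  have "n * A \<le> 288 * (12 / 49 * (3 / 7)) * ((n + 3) / 2 * R)" by (rule poly)
  also have "\<dots> \<le> 288 * (p * (1 - p) * p) * (T * R)"
    using p1 T R n by (intro mult_mono) auto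
  finally have key: "n * A \<le> 288 * (p * (1 - p) * p) * (T * R)" .
  have "n * (15 / 64 * T ^ 3 + b\<^sup>2 * (T / 4) + 2 * b * c * t + c\<^sup>2) \<le> n * (T * A)"
    using num n by (intro mult_left_mono) auto
  also have "\<dots> = T * (n * A)" by simp
  also have "\<dots> \<le> T * (288 * (p * (1 - p) * p) * (T * R))"
    using key T n by (intro mult_left_mono) auto
  also have "\<dots> = 288 * (T * (p * (1 - p)) * (T * p * R))" by (simp only: mult_ac)
  finally have "n * (15 / 64 * T ^ 3 + b\<^sup>2 * (T / 4) + 2 * b * c * t + c\<^sup>2)
      \<le> 288 * (T * (p * (1 - p)) * (T * p * R))" .
  moreover have "T * (p * (1 - p)) * (T * p * R) > 0"
    using p1 p t T R n by (intro mult_pos_pos) auto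
  moreover have "x / y \<le> 288 / n" if "n * x \<le> 288 * y" "y > 0" for x y
    using n that by (simp add: field_simps)
  ultimately show ?thesis
    unfolding R_def by blast
qed

text \<open>The weight at \<open>k\<close> of the binomial law moved by \<open>s\<close>. The guard
  is needed because \<open>k - s\<close> truncates to 0 below \<open>s\<close>.\<close>

definition shifted_binomial :: "nat \<Rightarrow> real \<Rightarrow> nat \<Rightarrow> nat \<Rightarrow> real" where
  "shifted_binomial N p s k = (if s \<le> k
     then real (N choose (k - s)) * p ^ (k - s) * (1 - p) ^ (N - (k - s)) else 0)"

text \<open>With \<open>J = z - (s - 1)\<close>, each term is at most a binomial weight for
  \<open>T = N + 1\<close> trials times a squared cubic over a constant; the moment bound and
  \<open>cubic_bound_div_le\<close> then finish.\<close>

lemma dirichlet_shifted_binomial_le: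
  fixes n N s :: nat and t :: real
  assumes n: "n \<ge> 13" and N: "N = n div 2 + 1" and t: "0 \<le> t" "real N * t \<le> 1 / 2"
    and p: "p = 1 / 2 - t" and s: "real s = (real n + 1) / 2 - real N * p"
  shows "(\<Sum>z\<in>{1..<n}. (sqrt (real z * (real z + 1) * shifted_binomial N p s (Suc z))
         - sqrt ((real n - real z) * (real n - real z + 1) * shifted_binomial N p s z))\<^sup>2) \<le> 288 / real n"
proof -
  define T where "T = Suc N"
  define F where "F z = (sqrt (real z * (real z + 1) * shifted_binomial N p s (Suc z))
         - sqrt ((real n - real z) * (real n - real z + 1) * shifted_binomial N p s z))\<^sup>2" for z
  have Nr: "real n / 2 + 1 / 2 \<le> real N" "real N \<le> real n / 2 + 1" "N \<ge> 7"
    using N n by auto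
  have Np: "real N * p = real N / 2 - real N * t" by (simp add: p algebra_simps)
  have Nt: "0 \<le> real N * t" using t by simp
  have nr: "real n \<ge> 13" using n by simp
  \<comment> \<open>Room of one on either side: \<open>z\<close> must run from \<open>s - 1\<close>
    to \<open>s + N\<close> within \<open>{1..<n}\<close>.\<close>
  have "real s \<ge> 2" using s Np Nr Nt nr by argo
  then have s2: "s \<ge> 2" by simp
  have "real s + real N + 1 \<le> real n" using s Np Nr t nr by argo
  then have sN: "s + N + 1 \<le> n" by linarith
  have t14: "t \<le> 1 / 14" using t Nr mult_right_mono[of 7 "real N" t] by simp
  have tn: "t * (real n + 1) \<le> 1"
    using t Nr mult_right_mono[of "(real n + 1) / 2" "real N" t] by (simp add: mult_ac)
  have p01: "0 < p" "p < 1" "p \<le> 1 - p" using p t t14 by auto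
  define H where "H = real T * p * ((real n / 4 - 3 / 2) * (real n / 4 - 1 / 2))"
  have H: "H > 0" unfolding H_def T_def using p01 n by (intro mult_pos_pos) auto
  define a where "a = t * (2 * real n + 1)"
  define b where "b = (real n + 1) * real T / 2 - (real n)\<^sup>2 / 4 - real n / 2 - 2 * t * (real n + 1) * (real N * t)"
  define c where "c = t * ((real n)\<^sup>2 / 4 + real n / 2)"
  have a0: "0 \<le> a" "a \<le> 2" "0 \<le> c" "c \<le> (real n + 1) / 4"
  proof -
    show "0 \<le> a" "0 \<le> c" using t by (simp_all add: a_def c_def)
    show "a \<le> 2" using tn t by (simp add: a_def algebra_simps)
    have "c = t * (real n + 1) * ((real n + 1) / 4) - t / 4"
      by (simp add: c_def power2_eq_square field_simps)
    also have "\<dots> \<le> 1 * ((real n + 1) / 4)"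
    proof -
      have "t * (real n + 1) * ((real n + 1) / 4) \<le> 1 * ((real n + 1) / 4)"
        by (rule mult_right_mono[OF tn]) simp
      then show ?thesis using t by linarith
    qed
    finally show "c \<le> (real n + 1) / 4" by simp
  qed
  have b0: "2 \<le> b" "b \<le> 3 * real n / 4 + 1"
  proof -
    define Y where "Y = (real n + 1) * real T"
    define U where "U = t * (real n + 1) * (real N * t)"
    \<comment> \<open>\<open>T\<close> is \<open>n / 2\<close> up to a bounded term, so
      \<open>Y / 2\<close> cancels the quadratic part of \<open>b\<close>, and \<open>U\<close> is
      at most \<open>1 / 2\<close>.\<close>
    have "(real n + 1) * (real n / 2 + 3 / 2) \<le> Y" "Y \<le> (real n + 1) * (real n / 2 + 2)"
      unfolding Y_def using Nr by (intro mult_left_mono; simp add: T_def)+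
    then have Y: "(real n)\<^sup>2 / 2 + 2 * real n + 3 / 2 \<le> Y" "Y \<le> (real n)\<^sup>2 / 2 + 5 * real n / 2 + 2"
      by (simp_all add: power2_eq_square field_simps)
    have "0 \<le> U" unfolding U_def using t by simp
    moreover have "U \<le> 1 * (1 / 2)" unfolding U_def using tn t by (intro mult_mono) auto
    moreover have "b = Y / 2 - (real n)\<^sup>2 / 4 - real n / 2 - 2 * U"
      unfolding b_def Y_def U_def by simp
    ultimately show "2 \<le> b" "b \<le> 3 * real n / 4 + 1" using Y nr by linarith+
  qed
  define G where "G w = a * w\<^sup>2 + b * w - c - w ^ 3" for w
  \<comment> \<open>\<open>F z\<close> involves the weights at \<open>z\<close> and
    \<open>z + 1\<close>, so its support has one point more than that of the binomial law.\<close>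
  have "(\<Sum>z\<in>{1..<n}. F z) = (\<Sum>z\<in>{s - 1..s - 1 + T}. F z)"
  proof (rule sum.mono_neutral_right)
    show "\<forall>z\<in>{1..<n} - {s - 1..s - 1 + T}. F z = 0"
      by (auto simp: F_def shifted_binomial_def T_def binomial_eq_0)
  qed (use s2 sN in \<open>auto simp: T_def\<close>)
  also have "\<dots> = (\<Sum>J\<le>T. F (s - 1 + J))"
    by (rule sum.reindex_bij_witness[of _ "\<lambda>J. s - 1 + J" "\<lambda>z. z - (s - 1)"]) auto
  also have "\<dots> \<le> (\<Sum>J\<le>T. real (T choose J) * p ^ J * (1 - p) ^ (T - J)
      * ((G (real J - real T * p - t))\<^sup>2 / (real T * (p * (1 - p)) * H)))"
  proof (intro sum_mono)
    fix J assume "J \<in> {..T}"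
    then have J: "J \<le> Suc N" by (simp add: T_def)
    define B where "B = real (T choose J) * p ^ J * (1 - p) ^ (T - J)"
    define e where "e = B / (real T * (p * (1 - p)))"
    define z where "z = s - 1 + J"
    \<comment> \<open>The extra \<open>- t\<close> makes \<open>z = n / 2 + w\<close>: the point
      \<open>J\<close> with \<open>z = n / 2\<close> is \<open>T * p + t\<close>.\<close>
    define w where "w = real J - real T * p - t"
    define x where "x = real z * (real z + 1) * ((real T - real J) * p)"
    define y where "y = (real n - real z) * (real n - real z + 1) * (real J * (1 - p))"
    have B: "B \<ge> 0" using p01 by (simp add: B_def)
    have e: "e \<ge> 0" unfolding e_def using B p01 by (intro divide_nonneg_nonneg mult_nonneg_nonneg) auto
    have w: "w = real J - (real N + 1) / 2 + real N * t"
      by (simp add: w_def T_def p field_simps)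
    have z: "real z = real n / 2 + w"
      unfolding w using s2 s Np by (simp add: z_def field_simps)
    have Jr: "real J \<le> real N + 1" "0 \<le> real J" "real J \<le> real T" using J by (simp_all add: T_def)
    have zl: "real z \<ge> real n / 4 - 1" unfolding z w using Nr(1,2) Nt Jr by argo
    have zu: "real n - real z \<ge> real n / 4 - 3 / 2" unfolding z w using Nr(1,2) t(2) Jr by argo
    have Qz: "shifted_binomial N p s (Suc z) = e * ((real T - real J) * p)"
      using s2 binomial_absorb_ratio(1)[OF p01(1,2) J]
      by (simp add: shifted_binomial_def z_def e_def B_def T_def)
    have Qz': "shifted_binomial N p s z = e * (real J * (1 - p))"
      using s2 binomial_absorb_ratio(2)[OF p01(1,2) J]
      by (auto simp add: shifted_binomial_def z_def e_def B_def T_def split: if_splits)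
    have nonneg: "0 \<le> x" "0 \<le> y"
      unfolding x_def y_def using zl zu n Jr p01 by (intro mult_nonneg_nonneg; simp)+
    have "F z = (sqrt (e * x) - sqrt (e * y))\<^sup>2"
      unfolding F_def Qz Qz' x_def y_def by (simp add: mult_ac)
    also have "\<dots> = e * (sqrt x - sqrt y)\<^sup>2"
      using e by (simp add: real_sqrt_mult right_diff_distrib[symmetric] power_mult_distrib)
    also have "\<dots> \<le> e * ((x - y)\<^sup>2 / H)"
    proof (intro mult_left_mono sqrt_diff_sq_le nonneg H e)
      \<comment> \<open>Both rates are at least \<open>r\<close>, and \<open>p \<le> 1 - p\<close>;
        hence \<open>x + y\<close> is at least \<open>r * T * p\<close>, which is
        \<open>H\<close>.\<close>
      define r where "r = (real n / 4 - 3 / 2) * (real n / 4 - 1 / 2)"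
      have "r \<ge> 0" unfolding r_def using n by (intro mult_nonneg_nonneg) auto
      have "r \<le> real z * (real z + 1)" "r \<le> (real n - real z) * (real n - real z + 1)"
        unfolding r_def using zl zu n by (intro mult_mono; simp)+
      then have "r * ((real T - real J) * p) \<le> x" "r * (real J * (1 - p)) \<le> y"
        unfolding x_def y_def using Jr p01 by (auto intro!: mult_right_mono)
      moreover have "r * (real J * p) \<le> r * (real J * (1 - p))"
        using p01 \<open>r \<ge> 0\<close> by (intro mult_left_mono) auto
      ultimately show "H \<le> x + y" unfolding H_def r_def[symmetric] by (simp add: algebra_simps)
    qed
    also have "x - y = G w"
    proof -
      have TJ: "real T - real J = (real N + 1) / 2 - w + real N * t"
        and J: "real J = (real N + 1) / 2 + w - real N * t"
        using w by (simp_all add: T_def field_simps)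
      have q: "1 - p = 1 / 2 + t" and nz: "real n - real z = real n / 2 - w" by (simp_all add: p z)
      have "x = (real n / 2 + w) * (real n / 2 + w + 1) * (((real N + 1) / 2 - w + real N * t) * (1 / 2 - t))"
        unfolding x_def TJ z by (simp only: p)
      moreover have "y = (real n / 2 - w) * (real n / 2 - w + 1) * (((real N + 1) / 2 + w - real N * t) * (1 / 2 + t))"
        unfolding y_def nz q by (simp only: J)
      moreover have "real T = real N + 1" by (simp add: T_def)
      ultimately show ?thesis
        unfolding G_def a_def b_def c_def by (simp only: drift_difference)
    qed
    finally show "F (s - 1 + J) \<le> real (T choose J) * p ^ J * (1 - p) ^ (T - J)
      * ((G (real J - real T * p - t))\<^sup>2 / (real T * (p * (1 - p)) * H))"
      unfolding z_def[symmetric] by (simp add: e_def B_def w_def)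
  qed
  also have "\<dots> = binomial_mean T p (\<lambda>J. (G (real J - real T * p - t))\<^sup>2) / (real T * (p * (1 - p)) * H)"
    by (simp add: binomial_mean_def sum_divide_distrib)
  also have "\<dots> \<le> (15 / 64 * real T ^ 3 + b\<^sup>2 * (real T / 4) + 2 * b * c * t + c\<^sup>2) / (real T * (p * (1 - p)) * H)"
  proof (rule divide_right_mono)
    show "0 \<le> real T * (p * (1 - p)) * H" using p01 H by simp
    show "binomial_mean T p (\<lambda>J. (G (real J - real T * p - t))\<^sup>2)
      \<le> 15 / 64 * real T ^ 3 + b\<^sup>2 * (real T / 4) + 2 * b * c * t + c\<^sup>2"
      unfolding G_def
    proof (rule binomial_mean_cubic_sq_le[OF p t(1) t14])
      show "8 \<le> T" using Nr by (simp add: T_def)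
    qed (use b0 a0 in auto)
  qed
  also have "\<dots> \<le> 288 / real n"
    unfolding H_def
    by (rule cubic_bound_div_le) (use n Nr t14 tn t p b0 a0 in \<open>auto simp: T_def\<close>)
  finally show ?thesis by (simp add: F_def)
qed

subsection \<open>The translated binomial distribution\<close>

text \<open>Here \<open>4 * v\<close> lies above \<open>n / 2\<close> and at most at
  \<open>(n + 1) / 2\<close>, which fixes the number of trials.\<close>

lemma tbin_parameters:
  fixes n :: nat and \<mu> v :: real
  assumes n: "n \<ge> 13" and \<mu>: "\<mu> = (real n + 1) / 2"
    and v: "v = (real n - 1) * (real n + 1) / (4 * (2 * real n - 1))"
  defines "N \<equiv> n div 2 + 1"
  defines "t \<equiv> tbin_t \<mu> v"
  defines "s \<equiv> nat \<lfloor>tbin_shift \<mu> v\<rfloor>"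
  shows "\<lceil>4 * v\<rceil> = int N" (is ?ceil) and "0 \<le> t" (is ?t0) and "real N * t \<le> 1 / 2" (is ?t1)
    and "real s = (real n + 1) / 2 - real N * (1 / 2 - t)" (is ?s1)
    and "\<lfloor>tbin_shift \<mu> v\<rfloor> = int s" (is ?s2)
proof -
  have nr: "real n \<ge> 13" using n by simp
  have Nr: "real n / 2 + 1 / 2 \<le> real N" "real N \<le> real n / 2 + 1"
    unfolding N_def by auto
  have v4: "4 * v = (real n - 1) * (real n + 1) / (2 * real n - 1)"
    unfolding v using nr by (simp add: field_simps)
  show ceil: ?ceil
  proof (rule ceiling_unique)
    have "(real N - 1) * (2 * real n - 1) \<le> real n / 2 * (2 * real n - 1)"
      using Nr nr by (intro mult_right_mono) auto
    also have "\<dots> < (real n - 1) * (real n + 1)" using nr by (simp add: algebra_simps)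
    finally show "real_of_int (int N) - 1 < 4 * v"
      unfolding v4 using nr by (simp add: pos_less_divide_eq)
    have "(real n - 1) * (real n + 1) \<le> (real n / 2 + 1 / 2) * (2 * real n - 1)"
      using nr by (simp add: algebra_simps)
    also have "\<dots> \<le> real N * (2 * real n - 1)"
      using Nr nr by (intro mult_right_mono) auto
    finally show "4 * v \<le> real_of_int (int N)"
      unfolding v4 using nr by (simp add: pos_divide_le_eq)
  qed
  \<comment> \<open>Twice the argument of \<open>frac\<close> is an integer, so its fractional part
    is 0 or \<open>1 / 2\<close>; this gives \<open>N * t \<le> 1 / 2\<close> instead of a bound by
    1.\<close>
  define y where "y = - \<mu> + 2 * v + tbin_delta v / 2"
  have y: "2 * y = real_of_int (int N - int n - 1)"
    using tbin_ceiling[of v] unfolding y_def \<mu> ceil by (simp add: field_simps)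
  define i where "i = int N - int n - 1 - 2 * \<lfloor>y\<rfloor>"
  have i: "2 * frac y = real_of_int i"
    using y unfolding frac_def i_def by simp
  then have "i < 2" using frac_lt_1[of y] by linarith
  then have y1: "frac y \<le> 1 / 2" using i by linarith
  have t: "t = frac y / real N" unfolding t_def tbin_t_def y_def[symmetric] ceil by simp
  show ?t0 unfolding t by simp
  show t1: ?t1 unfolding t using y1 by (simp add: N_def)
  have sh: "tbin_shift \<mu> v = (real n + 1) / 2 - real N * (1 / 2 - t)"
    unfolding tbin_shift_def t_def[symmetric] ceil by (simp add: \<mu>)
  have "v > 0" unfolding v using nr by simp
  then have int: "tbin_shift \<mu> v \<in> \<int>" by (rule tbin_shift_Ints)
  have "real N * t \<ge> 0" using \<open>?t0\<close> by simp
  \<comment> \<open>Nonnegativity ensures that \<open>nat\<close> in the definition of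
    \<open>s\<close> loses nothing.\<close>
  then have "tbin_shift \<mu> v \<ge> 0" unfolding sh using Nr nr by (simp add: right_diff_distrib)
  then have "real_of_int \<lfloor>tbin_shift \<mu> v\<rfloor> = tbin_shift \<mu> v" "\<lfloor>tbin_shift \<mu> v\<rfloor> \<ge> 0"
    using int by (auto elim: Ints_cases)
  then show ?s1 ?s2 unfolding sh[symmetric] s_def by simp_all
qed

lemma shifted_binomial_nonneg: "0 \<le> p \<Longrightarrow> p \<le> 1 \<Longrightarrow> shifted_binomial N p s k \<ge> 0"
  by (simp add: shifted_binomial_def)

section \<open>Both laws as finite sums over \<open>{1..n}\<close>\<close>

text \<open>The conditions on \<open>s\<close> put the whole support inside \<open>{1..n}\<close>,
  so every set of integers is measured by a sum over the range of the Narayana law.\<close>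

lemma measure_shifted_binomial:
  fixes A :: "int set"
  assumes p: "0 \<le> p" "p \<le> 1" and s: "1 \<le> s" "s + N \<le> n"
  shows "measure (measure_pmf (map_pmf (\<lambda>y. int y + int s) (binomial_pmf N p))) A
    = (\<Sum>k\<in>{k\<in>{1..n}. int k \<in> A}. shifted_binomial N p s k)"
proof -
  define M where "M = map_pmf (\<lambda>y. int y + int s) (binomial_pmf N p)"
  have pmf: "pmf M (int k) = shifted_binomial N p s k" for k
  proof (cases "s \<le> k")
    case True
    have "inj (\<lambda>y. int y + int s)" by (simp add: inj_on_def)
    then have "pmf M (int (k - s) + int s) = pmf (binomial_pmf N p) (k - s)"
      unfolding M_def by (rule pmf_map_inj')
    then show ?thesis using True p by (simp add: shifted_binomial_def of_nat_diff)
  next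
    case False
    then have "pmf M (int k) = 0" unfolding M_def by (intro pmf_map_outside) auto
    then show ?thesis using False by (simp add: shifted_binomial_def)
  qed
  have supp: "set_pmf M \<subseteq> int ` {1..n}"
  proof
    fix x assume "x \<in> set_pmf M"
    then obtain y where "y \<in> set_pmf (binomial_pmf N p)" "x = int (y + s)" unfolding M_def by auto
    moreover from this have "y \<le> N"
      using p by (metis atMost_iff binomial_eq_0 not_le mult_zero_left of_nat_0 pmf_binomial set_pmf_iff)
    ultimately show "x \<in> int ` {1..n}" using s by (auto intro!: image_eqI[of _ int "y + s"])
  qed
  have "measure (measure_pmf M) A = measure (measure_pmf M) (int ` {k\<in>{1..n}. int k \<in> A})"
    using supp by (intro measure_pmf.finite_measure_eq_AE) (auto intro!: AE_pmfI)
  also have "\<dots> = (\<Sum>k\<in>{k\<in>{1..n}. int k \<in> A}. shifted_binomial N p s k)"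
    by (simp add: measure_measure_pmf_finite sum.reindex pmf)
  finally show ?thesis unfolding M_def .
qed

lemma measure_distr_nat_valued:
  fixes K :: "'a \<Rightarrow> int"
  assumes "prob_space M" and K: "K \<in> measurable M (count_space UNIV)"
    and range: "\<And>\<omega>. \<omega> \<in> space M \<Longrightarrow> K \<omega> \<in> {1..int n}"
  shows "measure (distr M (count_space UNIV) K) A
    = (\<Sum>k\<in>{k\<in>{1..n}. int k \<in> A}. measure M {\<omega> \<in> space M. K \<omega> = int k})"
proof -
  interpret prob_space M by fact
  have "measure (distr M (count_space UNIV) K) A = measure M (K -` A \<inter> space M)"
    by (rule measure_distr[OF K]) simp
  also have "K -` A \<inter> space M = (\<Union>k\<in>{k\<in>{1..n}. int k \<in> A}. {\<omega> \<in> space M. K \<omega> = int k})"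
  proof (intro set_eqI iffI)
    fix \<omega> assume \<omega>: "\<omega> \<in> K -` A \<inter> space M"
    then have "K \<omega> \<in> {1..int n}" using range by auto
    then show "\<omega> \<in> (\<Union>k\<in>{k\<in>{1..n}. int k \<in> A}. {\<omega> \<in> space M. K \<omega> = int k})"
      using \<omega> by (intro UN_I[of "nat (K \<omega>)"]) auto
  qed auto
  also have "measure M \<dots> = (\<Sum>k\<in>{k\<in>{1..n}. int k \<in> A}. measure M {\<omega> \<in> space M. K \<omega> = int k})"
  proof (rule finite_measure_finite_Union)
    have "K -` {int k} \<inter> space M \<in> events" for k
      by (rule measurable_sets[OF K]) simp
    then have "{\<omega> \<in> space M. K \<omega> = int k} \<in> events" for k
      by (simp add: vimage_def Int_def conj_commute)
    then show "(\<lambda>k. {\<omega> \<in> space M. K \<omega> = int k}) ` {k \<in> {1..n}. int k \<in> A} \<subseteq> events"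
      by blast
  qed (auto simp: disjoint_family_on_def)
  finally show ?thesis .
qed

theorem theorem1p1:
  fixes n :: nat and M :: "'a measure" and K :: "'a \<Rightarrow> int" and \<mu> v :: real
  assumes "n \<ge> 2"
    and "prob_space M"
    and "K \<in> measurable M (count_space UNIV)"
    and "\<And>\<omega>. \<omega> \<in> space M \<Longrightarrow> K \<omega> \<in> {1..int n}"
    and "\<And>k. k \<in> {1..n} \<Longrightarrow>
           measure M {\<omega> \<in> space M. K \<omega> = int k} = narayana n k / catalan n"
    and "\<mu> = (real n + 1) / 2"
    and "v = (real n - 1) * (real n + 1) / (4 * (2 * real n - 1))"
  shows "tv_dist (distr M (count_space UNIV) K) (measure_pmf (tbin_pmf \<mu> v)) \<le> 12 / real n"
  unfolding tv_dist_def
proof (rule cSUP_least)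
  fix A :: "int set"
  let ?P = "distr M (count_space UNIV) K" and ?Q = "measure_pmf (tbin_pmf \<mu> v)"
  interpret P: prob_space ?P by (rule prob_space.prob_space_distr) fact+
  show "\<bar>measure ?P A - measure ?Q A\<bar> \<le> 12 / real n"
  proof (cases "n \<ge> 13")
    case False
    have "\<bar>measure ?P A - measure ?Q A\<bar> \<le> 1"
      using P.prob_le_1[of A] measure_pmf.prob_le_1[of "tbin_pmf \<mu> v" A]
        measure_nonneg[of ?P A] measure_nonneg[of ?Q A] by linarith
    also have "1 \<le> 12 / real n" using False assms(1) by simp
    finally show ?thesis .
  next
    case True
    define N where "N = n div 2 + 1"
    define t where "t = tbin_t \<mu> v"
    define p where "p = 1 / 2 - t"
    define s where "s = nat \<lfloor>tbin_shift \<mu> v\<rfloor>"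
    define S where "S = {k\<in>{1..n}. int k \<in> A}"
    note par = tbin_parameters[OF True assms(6,7), folded N_def t_def s_def, folded p_def]
    have nr: "real n \<ge> 13" using True by simp
    have Nr: "real N \<ge> 7" "real N \<le> real n / 2 + 1" using True by (auto simp: N_def)
    have "7 * t \<le> real N * t" using Nr par(2) by (intro mult_right_mono) auto
    then have t14: "t \<le> 1 / 14" using par(3) by linarith
    then have p: "0 \<le> p" "p \<le> 1" using par(2) by (auto simp: p_def)
    have Np: "real N * p = real N / 2 - real N * t" "real N * t \<ge> 0"
      using par(2) by (auto simp: p_def algebra_simps)
    have "real s \<ge> 1" unfolding par(4) Np using Np Nr nr by argo
    moreover have "real s + real N \<le> real n" unfolding par(4) Np using par(3) Nr nr by argo
    ultimately have s: "1 \<le> s" "s + N \<le> n" by linarith+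
    \<comment> \<open>Stated for every \<open>B\<close>: the set \<open>A\<close> gives the
      probability to compare, and \<open>UNIV\<close> the total mass 1.\<close>
    have Q: "measure ?Q B = (\<Sum>k\<in>{k\<in>{1..n}. int k \<in> B}. shifted_binomial N p s k)" for B
      unfolding tbin_pmf_def par(1,5) t_def[symmetric] p_def[symmetric] nat_int
      by (rule measure_shifted_binomial[OF p s])
    have "measure ?P A = (\<Sum>k\<in>S. measure M {\<omega> \<in> space M. K \<omega> = int k})"
      unfolding S_def using assms(2-4) by (rule measure_distr_nat_valued)
    also have "\<dots> = (\<Sum>k\<in>S. narayana n k / catalan n)"
      by (rule sum.cong[OF refl], rule assms(5)) (simp add: S_def)
    finally have "measure ?P A = \<dots>" .
    then have "(measure ?P A - measure ?Q A)\<^sup>2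
      = ((\<Sum>k\<in>S. narayana n k / catalan n) - (\<Sum>k\<in>S. shifted_binomial N p s k))\<^sup>2"
      unfolding Q S_def by simp
    also have "\<dots> \<le> (\<Sum>z\<in>{1..<n}. (sqrt (real z * (real z + 1) * shifted_binomial N p s (Suc z))
         - sqrt ((real n - real z) * (real n - real z + 1) * shifted_binomial N p s z))\<^sup>2) / (2 * real n)"
    proof (rule narayana_tv_dirichlet)
      have "{k. Suc 0 \<le> k \<and> k \<le> n} = {Suc 0..n}" by auto
      then show "(\<Sum>k\<in>{1..n}. shifted_binomial N p s k) = 1"
        using Q[of UNIV] measure_pmf.prob_space[of "tbin_pmf \<mu> v"] by simp
    qed (use p True in \<open>auto simp: S_def shifted_binomial_nonneg\<close>)
    also have "\<dots> \<le> 288 / real n / (2 * real n)"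
      using dirichlet_shifted_binomial_le[OF True N_def par(2,3) p_def par(4)]
      by (rule divide_right_mono) simp
    \<comment> \<open>The right side is an exact square, so taking roots gives the claim.\<close>
    also have "\<dots> = (12 / real n)\<^sup>2" by (simp add: power2_eq_square)
    finally show ?thesis by (simp add: power2_le_iff_abs_le)
  qed
qed simp

end
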